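(* Let $d,r\in\mathbb{N}$, $\varepsilon\in(0,1)$, $M\in(0,r!\,\varepsilon]$ and let $n\in\mathbb{N}$ satisfy $n\ge d\max\{\varepsilon^{-1/r}(d\,C_r M)^{1/r},2\}$. Then, for every $f\in F^r_{M,d}$, $$ \mathbb{P}\left(\|f-S_{1,n}(f)\|_\infty\le\varepsilon\right)=1 . $$ Hence $\lceil d\max\{\varepsilon^{-1/r}(d\,C_rM)^{1/r},2\}\rceil+1$ function values lead to an $\varepsilon$ approximation of $f$ with probability $1$.
   Context: $\mathbb{N}=\{1,2,\dots\}$. For $r\in\mathbb{N}$, $W^r_\infty[0,1]$ is the set of all (continuous) functions $g:[0,1]\to\mathbb{R}$ which have $r$ weak derivatives in $L_\infty$; $g^{(r)}$ denotes the $r$th weak derivative. For $d\in\mathbb{N}$ and $M>0$, $F^r_{M,d}$ is the set of all functions $f:[0,1]^d\to\mathbb{R}$ of the form $f(x_1,\dots,x_d)=\prod_{i=1}^d f_i(x_i)$ with $f_i\in W^r_\infty[0,1]$, $\|f_i\|_\infty\le 1$ and $\|f_i^{(r)}\|_\infty\le M$ for all $i$. The constant $C_r$ and the algorithm $A_n$ (a known result of Bachmayr, Dahmen, DeVore and Grasedyck, to be taken as given): for each $r\in\mathbb{N}$ there is a constant $C_r>0$, depending only on $r$ and fixed once and for all, such that for all $d\in\mathbb{N}$, $M>0$, all integers $n\ge d\max\{(d\,C_rM)^{1/r},2\}$ and all $z^*\in[0,1]^d$ there is a deterministic (possibly adaptive) algorithm $A_n=A_{n,z^*}$ using $n$ function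 values with $\|f-A_n(f)\|_\infty\le C_r M d^{r+1}n^{-r}$ for every $f\in F^r_{M,d}$ with $f(z^* )\neq0$. The randomized algorithm $S_{1,n}$: let $X$ be a uniformly distributed random variable in $[0,1]^d$ on a probability space $(\Omega,\mathcal{F},\mathbb{P})$. For $f\in F^r_{M,d}$ and $\omega\in\Omega$ set $x=X(\omega)$. If $f(x)=0$, return $S_{1,n}(f)(\omega)=0$. If $f(x)\ne0$, run the algorithm $A_n$ above with $z^*=x$ and return $S_{1,n}(f)(\omega)=A_n(f)$. *)

theory Defs
  imports "HOL-Probability.Probability"
begin

type_synonym point = "nat \<Rightarrow> real"

(* Points of [0,1]^d are indexed by {1..d} and extensional (undefined at other indices);
   this set is the space of cube_measure d below. *)
definition cube :: "nat \<Rightarrow> point set" where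
  "cube d = (\<Pi>\<^sub>E i\<in>{1..d}. {0..1})"

definition cube_measure :: "nat \<Rightarrow> point measure" where
  "cube_measure d = Pi\<^sub>M {1..d} (\<lambda>_. restrict_space lborel {0..1})"

lemma space_cube_measure: "space (cube_measure d) = cube d"
  by (simp add: cube_measure_def cube_def space_PiM space_restrict_space)

lemma prob_space_cube_measure: "prob_space (cube_measure d)"
proof -
  have "prob_space (restrict_space lborel {0..1::real})"
    by (intro prob_spaceI) (simp add: emeasure_restrict_space space_restrict_space)
  then show ?thesis
    unfolding cube_measure_def by (intro prob_space_PiM)
qed

(* Lebesgue measure on the cube has total mass 1, so the uniform density is 1. *)
definition uniform_on_cube :: "'w measure \<Rightarrow> nat \<Rightarrow> ('w \<Rightarrow> point) \<Rightarrow> bool" where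
  "uniform_on_cube P d X \<longleftrightarrow> distributed P (cube_measure d) X (\<lambda>_. 1)"

(* Extended real values: the supremum is \<infinity> for functions unbounded on D. *)
definition sup_norm :: "'a set \<Rightarrow> ('a \<Rightarrow> real) \<Rightarrow> ereal" where
  "sup_norm D g = (SUP x\<in>D. ereal \<bar>g x\<bar>)"

definition Linf_norm :: "(real \<Rightarrow> real) \<Rightarrow> ereal" where
  "Linf_norm h = esssup (lebesgue_on {0..1}) (\<lambda>x. ereal \<bar>h x\<bar>)"

definition Linf :: "(real \<Rightarrow> real) set" where
  "Linf = {h \<in> borel_measurable (lebesgue_on {0..1}). Linf_norm h < \<infinity>}"

(* Smooth functions on the real line with compact support inside the open interval (0,1). *)
definition test_function :: "(real \<Rightarrow> real) \<Rightarrow> bool" where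
  "test_function \<phi> \<longleftrightarrow>
     (\<forall>k x. (deriv ^^ k) \<phi> differentiable (at x)) \<and>
     (\<exists>a b. 0 < a \<and> a \<le> b \<and> b < 1 \<and> (\<forall>x. x \<notin> {a..b} \<longrightarrow> \<phi> x = 0))"

(* h is a k-th weak derivative of g on (0,1). It is only used for continuous g and h in Linf,
   where both integrands are integrable and h is unique up to null sets. *)
definition weak_derivative :: "nat \<Rightarrow> (real \<Rightarrow> real) \<Rightarrow> (real \<Rightarrow> real) \<Rightarrow> bool" where
  "weak_derivative k g h \<longleftrightarrow>
     (\<forall>\<phi>. test_function \<phi> \<longrightarrow>
        integral\<^sup>L (lebesgue_on {0..1}) (\<lambda>x. g x * (deriv ^^ k) \<phi> x) =
        (-1) ^ k * integral\<^sup>L (lebesgue_on {0..1}) (\<lambda>x. h x * \<phi> x))"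

definition sobolev_inf :: "nat \<Rightarrow> (real \<Rightarrow> real) set" where
  "sobolev_inf r =
     {g. continuous_on {0..1} g \<and> (\<forall>k\<in>{1..r}. \<exists>h\<in>Linf. weak_derivative k g h)}"

(* Membership depends only on the values of f on the cube. *)
definition rank_one_class :: "nat \<Rightarrow> real \<Rightarrow> nat \<Rightarrow> (point \<Rightarrow> real) set" where
  "rank_one_class r M d =
     {f. \<exists>fs. (\<forall>i\<in>{1..d}. fs i \<in> sobolev_inf r \<and> sup_norm {0..1} (fs i) \<le> 1 \<and>
                 (\<exists>h\<in>Linf. weak_derivative r (fs i) h \<and> Linf_norm h \<le> ereal M)) \<and>
              (\<forall>x\<in>cube d. f x = (\<Prod>i=1..d. fs i (x i)))}"

(* The first n observed values of f; each node is chosen from the values observed before. *)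
primrec observe :: "(real list \<Rightarrow> 'a) \<Rightarrow> ('a \<Rightarrow> real) \<Rightarrow> nat \<Rightarrow> real list" where
  "observe q f 0 = []"
| "observe q f (Suc k) = observe q f k @ [f (q (observe q f k))]"

(* S is an adaptive deterministic algorithm using n values of its argument on D.
   An algorithm that stops earlier is covered by ignoring the surplus values. *)
definition deterministic_algorithm ::
    "'a set \<Rightarrow> nat \<Rightarrow> (('a \<Rightarrow> real) \<Rightarrow> ('a \<Rightarrow> real)) \<Rightarrow> bool" where
  "deterministic_algorithm D n S \<longleftrightarrow>
     (\<exists>q out. (\<forall>y. q y \<in> D) \<and> (\<forall>f. S f = out (observe q f n)))"

(* c plays the role of C_r, and A n z that of A_n with starting point z. *)
definition rank_one_algorithms ::
    "real \<Rightarrow> nat \<Rightarrow> real \<Rightarrow> nat \<Rightarrow> (nat \<Rightarrow> point \<Rightarrow> (point \<Rightarrow> real) \<Rightarrow> (point \<Rightarrow> real)) \<Rightarrow> bool" where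
  "rank_one_algorithms c r M d A \<longleftrightarrow>
     (\<forall>n z. real n \<ge> real d * max ((real d * c * M) powr (1 / real r)) 2 \<longrightarrow> z \<in> cube d \<longrightarrow>
        deterministic_algorithm (cube d) n (A n z) \<and>
        (\<forall>f\<in>rank_one_class r M d. f z \<noteq> 0 \<longrightarrow>
           sup_norm (cube d) (\<lambda>x. f x - A n z f x)
             \<le> ereal (c * M * real d ^ (r + 1) / real n ^ r)))"

definition S1 ::
    "(nat \<Rightarrow> point \<Rightarrow> (point \<Rightarrow> real) \<Rightarrow> (point \<Rightarrow> real)) \<Rightarrow> ('w \<Rightarrow> point) \<Rightarrow> nat \<Rightarrow>
     (point \<Rightarrow> real) \<Rightarrow> 'w \<Rightarrow> (point \<Rightarrow> real)" where
  "S1 A X n f \<omega> = (if f (X \<omega>) = 0 then (\<lambda>_. 0) else A n (X \<omega>) f)"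

definition sample_bound :: "real \<Rightarrow> nat \<Rightarrow> real \<Rightarrow> nat \<Rightarrow> real \<Rightarrow> real" where
  "sample_bound c r M d \<epsilon> =
     real d * max (\<epsilon> powr (- 1 / real r) * (real d * c * M) powr (1 / real r)) 2"

end

theory Submission
  imports Defs
begin

text \<open>If a factor \<open>g\<close> of \<open>f\<close> has \<open>r\<close> distinct zeros, then the error formula for interpolation at
  these zeros gives \<open>\<bar>g x\<bar> \<le> M / r! \<le> \<epsilon>\<close>, so the output 0 is good enough as well. Otherwise every
  factor has finitely many zeros, and a random point almost surely avoids the zeros of \<open>f\<close>. In both
  cases the success event is measurable: it is the whole space or the complement of finitely many
  hyperplanes.

  For weak derivatives the interpolation error is a bound on divided differences of \<open>g\<close>, obtained by
  testing with a smoothed B-spline. Its \<open>r\<close>th derivative is up to sign a divided difference of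
  bumps \<open>\<rho> (x - t)\<close>; its own sign, support and integral follow from the classical mean value
  theorem for divided differences.\<close>

section \<open>Smooth functions given with all their derivatives\<close>

text \<open>Carrying the whole sequence of derivatives makes differentiation a shift of the index
  and integration the prepending of one entry, so inductions on the order need no further smoothness
  arguments.\<close>

definition derivative_chain :: "(nat \<Rightarrow> real \<Rightarrow> real) \<Rightarrow> bool" where
  "derivative_chain F \<longleftrightarrow> (\<forall>k x. (F k has_real_derivative F (Suc k) x) (at x))"

lemma derivative_chain_funpow_deriv:
  assumes "derivative_chain F"
  shows "(deriv ^^ k) (F 0) = F k"
proof (induction k)
  case (Suc k)
  have "deriv (F k) = F (Suc k)"
    using assms by (auto simp: derivative_chain_def intro!: ext DERIV_imp_deriv)
  then show ?case using Suc by simp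
qed simp

lemma derivative_chain_continuous:
  assumes "derivative_chain F"
  shows "continuous_on S (F k)"
  using assms unfolding derivative_chain_def
  by (meson DERIV_isCont continuous_at_imp_continuous_on)

text \<open>Smoothness reduces to finding a class of functions that contains the derivative of each
  of its members; the iterated \<open>deriv\<close> then never leaves the class.\<close>

lemma derivative_chain_of_closed:
  assumes "f \<in> S" and closed: "\<And>g. g \<in> S \<Longrightarrow> \<exists>g'\<in>S. \<forall>x. (g has_real_derivative g' x) (at x)"
  shows "\<exists>F. F 0 = f \<and> derivative_chain F"
proof -
  have *: "deriv g \<in> S \<and> (\<forall>x. (g has_real_derivative deriv g x) (at x))" if g: "g \<in> S" for g
  proof -
    from closed[OF g] obtain g' where g': "g' \<in> S" "\<forall>x. (g has_real_derivative g' x) (at x)"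
      by blast
    then have "deriv g = g'" by (auto intro: DERIV_imp_deriv)
    with g' show ?thesis by simp
  qed
  have in_S: "(deriv ^^ k) f \<in> S" for k
    by (induction k) (use assms(1) * in auto)
  have "derivative_chain (\<lambda>k. (deriv ^^ k) f)"
    using *[OF in_S] by (simp add: derivative_chain_def)
  then show ?thesis by (intro exI[of _ "\<lambda>k. (deriv ^^ k) f"]) simp
qed

section \<open>Smooth bumps and their iterated primitives\<close>

text \<open>For \<open>p = 1\<close> this is the classical function exp(-1/x), extended by 0, with
  all derivatives zero at the origin. The polynomial in 1/x makes the family closed under
  differentiation.\<close>

definition flat :: "real poly \<Rightarrow> real \<Rightarrow> real" where
  "flat p x = (if x > 0 then poly p (1 / x) * exp (- (1 / x)) else 0)"

lemma poly_div_exp_tendsto_0: "((\<lambda>x::real. poly p x / exp x) \<longlongrightarrow> 0) at_top"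
proof -
  have "((\<lambda>x::real. \<Sum>i\<le>degree p. coeff p i * (x ^ i / exp x)) \<longlongrightarrow> (\<Sum>i\<le>degree p. coeff p i * 0)) at_top"
    by (intro tendsto_intros tendsto_power_div_exp_0)
  then show ?thesis by (simp add: poly_altdef sum_divide_distrib)
qed

text \<open>With u = 1/x, the derivative of p(u) exp(-u) in x is u^2 (p(u) - p'(u)) exp(-u), whence
  the polynomial in the conclusion. At 0 the exponential beats every power of u.\<close>

lemma flat_has_derivative:
  "(flat p has_real_derivative flat ([:0, 0, 1:] * (p - pderiv p)) x) (at x)"
proof -
  consider "x > 0" | "x < 0" | "x = 0" by linarith
  then show ?thesis
  proof cases
    case 1
    have D: "((\<lambda>x. poly p (1 / x) * exp (- (1 / x))) has_real_derivative
        flat ([:0, 0, 1:] * (p - pderiv p)) x) (at x)"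
      using 1 by (auto intro!: derivative_eq_intros DERIV_chain2[OF poly_DERIV]
          simp: flat_def field_simps power2_eq_square)
    have E: "\<forall>\<^sub>F y in nhds x. poly p (1 / y) * exp (- (1 / y)) = flat p y"
      using eventually_nhds_in_open[of "{0<..}" x] 1
      by (auto elim!: eventually_mono simp: flat_def)
    show ?thesis by (rule iffD1[OF DERIV_cong_ev[OF refl E refl] D])
  next
    case 2
    have E: "\<forall>\<^sub>F y in nhds x. 0 = flat p y"
      using eventually_nhds_in_open[of "{..<0}" x] 2
      by (auto elim!: eventually_mono simp: flat_def)
    have D: "((\<lambda>x. 0) has_real_derivative flat ([:0, 0, 1:] * (p - pderiv p)) x) (at x)"
      using 2 by (simp add: flat_def)
    show ?thesis by (rule iffD1[OF DERIV_cong_ev[OF refl E refl] D])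
  next
    case 3
    \<comment> \<open>\<open>pCons 0 p\<close> multiplies by the variable 1/h and so absorbs the
      denominator of the difference quotient.\<close>
    have "((\<lambda>h. poly (pCons 0 p) (inverse h) / exp (inverse h)) \<longlongrightarrow> 0) (at_right 0)"
      by (rule filterlim_compose[OF poly_div_exp_tendsto_0 filterlim_inverse_at_top_right])
    then have "((\<lambda>h. flat p h / h) \<longlongrightarrow> 0) (at_right 0)"
      by (rule Lim_transform_eventually)
         (auto simp: eventually_at_right_less flat_def field_simps exp_minus
            intro!: eventually_at_rightI[of 0 1])
    moreover have "((\<lambda>h. flat p h / h) \<longlongrightarrow> 0) (at_left 0)"
      by (rule Lim_transform_eventually[OF tendsto_const])
         (auto simp: flat_def intro!: eventually_at_leftI[of "-1" 0])
    ultimately have "((\<lambda>h. flat p h / h) \<longlongrightarrow> 0) (at 0)"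
      by (simp add: filterlim_split_at)
    then show ?thesis using 3 by (simp add: DERIV_def flat_def)
  qed
qed

inductive_set flat_products :: "real \<Rightarrow> (real \<Rightarrow> real) set" for \<delta> where
  product: "(\<lambda>x. flat p (x + \<delta>) * flat q (\<delta> - x)) \<in> flat_products \<delta>"
| sum: "f \<in> flat_products \<delta> \<Longrightarrow> g \<in> flat_products \<delta> \<Longrightarrow> (\<lambda>x. f x + g x) \<in> flat_products \<delta>"

lemma flat_products_derivative:
  assumes "f \<in> flat_products \<delta>"
  shows "\<exists>f'\<in>flat_products \<delta>. \<forall>x. (f has_real_derivative f' x) (at x)"
  using assms
proof induction
  case (product p q)
  let ?D = "\<lambda>p. [:0, 0, 1:] * (p - pderiv p)"
  \<comment> \<open>The inner derivative -1 of \<open>\<delta> - x\<close> is absorbed into the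
    polynomial, so that the family needs no closure under negation.\<close>
  have minus: "flat (- p) x = - flat p x" for p x
    by (simp add: flat_def)
  have "((\<lambda>x. flat p (x + \<delta>) * flat q (\<delta> - x)) has_real_derivative
     (flat (?D p) (x + \<delta>) * flat q (\<delta> - x) + flat p (x + \<delta>) * flat (- ?D q) (\<delta> - x))) (at x)" for x
    unfolding minus
    by (auto intro!: derivative_eq_intros DERIV_chain2[OF flat_has_derivative] simp: minus)
  then show ?case
    by (intro bexI[of _ "\<lambda>x. flat (?D p) (x + \<delta>) * flat q (\<delta> - x) + flat p (x + \<delta>) * flat (- ?D q) (\<delta> - x)"])
       (auto intro: flat_products.intros)
next
  case (sum f g)
  then obtain f' g' where "f' \<in> flat_products \<delta>" "g' \<in> flat_products \<delta>"
    "\<forall>x. (f has_real_derivative f' x) (at x)" "\<forall>x. (g has_real_derivative g' x) (at x)" by blast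
  then show ?case
    by (intro bexI[of _ "\<lambda>x. f' x + g' x"]) (auto intro: flat_products.intros DERIV_add)
qed

lemma continuous_has_antiderivative:
  fixes f :: "real \<Rightarrow> real"
  assumes "\<And>x. isCont f x"
  shows "\<exists>G. \<forall>x. (G has_real_derivative f x) (at x)"
  using einterval_antiderivative[of "-\<infinity>" "\<infinity>" f] assms
  by (auto simp: has_real_derivative_iff_has_vector_derivative)

lemma derivative_chain_prepend:
  assumes "derivative_chain F" and "\<And>x. (G has_real_derivative F 0 x) (at x)"
  shows "derivative_chain (case_nat G F)"
  using assms by (auto simp: derivative_chain_def split: nat.split)

text \<open>\<open>R (Suc m)\<close> is a bump of integral 1, \<open>R m\<close> its primitive, a
  smoothed unit step, and the entries below are further primitives. The induction on
  \<open>m\<close> integrates once more and prepends the result.\<close>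

lemma mollifier_chain:
  fixes \<delta> :: real
  assumes "\<delta> > 0"
  shows "\<exists>R. derivative_chain R \<and> (\<forall>x. R (Suc m) x \<ge> 0) \<and>
     (\<forall>x. \<bar>x\<bar> \<ge> \<delta> \<longrightarrow> R (Suc m) x = 0) \<and> (\<forall>x\<le>-\<delta>. R m x = 0) \<and> (\<forall>x\<ge>\<delta>. R m x = 1)"
proof (induction m)
  case 0
  obtain F where F: "F 0 = (\<lambda>x. flat 1 (x + \<delta>) * flat 1 (\<delta> - x))" "derivative_chain F"
    using derivative_chain_of_closed[OF flat_products.product flat_products_derivative, of \<delta> 1 1]
    by blast
  have nonneg: "F 0 x \<ge> 0" and supp: "\<bar>x\<bar> \<ge> \<delta> \<Longrightarrow> F 0 x = 0"
    and pos: "\<bar>x\<bar> < \<delta> \<Longrightarrow> F 0 x > 0" for x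
    using assms by (auto simp: F flat_def)
  obtain G where G: "\<And>x. (G has_real_derivative F 0 x) (at x)"
    using continuous_has_antiderivative[of "F 0"] F(2)
    by (metis DERIV_isCont derivative_chain_def)
  \<comment> \<open>The total mass of the bump; dividing by it makes the step rise to exactly
    1.\<close>
  define \<kappa> where "\<kappa> = G \<delta> - G (-\<delta>)"
  have const: "G x = G y" if "x \<le> y" "\<And>t. x < t \<Longrightarrow> t < y \<Longrightarrow> \<bar>t\<bar> \<ge> \<delta>" for x y
  proof (cases "x = y")
    case False
    with that(1) have "x < y" by simp
    then obtain z where "x < z" "z < y" "G y - G x = (y - x) * F 0 z"
      using MVT2[of x y G "F 0"] G by blast
    then show ?thesis using that(2)[of z] supp[of z] by simp
  qed simp
  have "\<kappa> > 0"
  proof -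
    obtain z where "-\<delta> < z" "z < \<delta>" "G \<delta> - G (-\<delta>) = (\<delta> - (-\<delta>)) * F 0 z"
      using MVT2[of "-\<delta>" \<delta> G "F 0"] G assms by auto
    then show ?thesis using pos[of z] assms by (simp add: \<kappa>_def)
  qed
  let ?R = "case_nat (\<lambda>x. (G x - G (-\<delta>)) / \<kappa>) (\<lambda>k x. F k x / \<kappa>)"
  have "derivative_chain (\<lambda>k x. F k x / \<kappa>)"
    using F(2) by (auto simp: derivative_chain_def intro!: DERIV_cdivide)
  moreover have "((\<lambda>x. (G x - G (-\<delta>)) / \<kappa>) has_real_derivative F 0 x / \<kappa>) (at x)" for x
    using \<open>\<kappa> > 0\<close> by (auto intro!: derivative_eq_intros G)
  ultimately have chain: "derivative_chain ?R"
    by (intro derivative_chain_prepend)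
  have left: "(G x - G (-\<delta>)) / \<kappa> = 0" if "x \<le> -\<delta>" for x
    using const[of x "-\<delta>"] that by auto
  have right: "(G x - G (-\<delta>)) / \<kappa> = 1" if "x \<ge> \<delta>" for x
    using const[of \<delta> x] that \<open>\<kappa> > 0\<close> by (auto simp: \<kappa>_def)
  have "F 0 x / \<kappa> \<ge> 0" for x
    using nonneg[of x] \<open>\<kappa> > 0\<close> by simp
  then show ?case
    unfolding old.nat.case
    by (intro exI[of _ ?R] conjI allI impI chain) (simp_all add: left right supp)
next
  case (Suc m)
  then obtain R where R: "derivative_chain R" "\<forall>x. R (Suc m) x \<ge> 0"
    "\<forall>x. \<bar>x\<bar> \<ge> \<delta> \<longrightarrow> R (Suc m) x = 0" "\<forall>x\<le>-\<delta>. R m x = 0" "\<forall>x\<ge>\<delta>. R m x = 1" by blast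
  obtain G where G: "\<And>x. (G has_real_derivative R 0 x) (at x)"
    using continuous_has_antiderivative[of "R 0"] R(1)
    by (metis DERIV_isCont derivative_chain_def)
  show ?case
    by (intro exI[of _ "case_nat G R"] conjI derivative_chain_prepend) (use R G in auto)
qed

section \<open>Rolle's theorem and divided differences\<close>

text \<open>Every point of \<open>T\<close> except the largest has a successor in \<open>T\<close>,
  and the mean value theorem gives a zero of \<open>f'\<close> strictly between the two. These gaps
  are disjoint, so the zeros found are distinct and just one is lost.\<close>

lemma Rolle_finite_set:
  fixes f :: "real \<Rightarrow> real"
  assumes "\<And>x. (f has_real_derivative f' x) (at x)"
    and "finite T" "card T = Suc n" "T \<subseteq> {a..b}" "\<And>t. t \<in> T \<Longrightarrow> f t = 0"
  shows "\<exists>U. finite U \<and> card U = n \<and> U \<subseteq> {a..b} \<and> (\<forall>u\<in>U. f' u = 0)"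
proof -
  have ne: "T \<noteq> {}" using assms by auto
  let ?T = "T - {Max T}"
  define next_zero where "next_zero t = Min {s\<in>T. t < s}" for t
  have next_in: "next_zero t \<in> {s\<in>T. t < s}" if "t \<in> ?T" for t
  proof -
    have "Max T \<in> {s\<in>T. t < s}"
      using that Max_in[OF assms(2) ne] Max_ge[OF assms(2), of t] by auto
    then show ?thesis
      unfolding next_zero_def using assms(2) by (intro Min_in) auto
  qed
  have next_le: "next_zero t \<le> s" if "s \<in> T" "t < s" for s t
    unfolding next_zero_def by (rule Min_le) (use that assms(2) in auto)
  have "\<exists>z. t < z \<and> z < next_zero t \<and> f' z = 0" if t: "t \<in> ?T" for t
  proof -
    have "t < next_zero t" "next_zero t \<in> T" using next_in[OF t] by auto
    then obtain z where "t < z" "z < next_zero t" "f (next_zero t) - f t = (next_zero t - t) * f' z"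
      using MVT2[of t "next_zero t" f f'] assms(1) by blast
    then show ?thesis using assms(5) t \<open>next_zero t \<in> T\<close> by auto
  qed
  then obtain z where z: "\<And>t. t \<in> ?T \<Longrightarrow> t < z t \<and> z t < next_zero t \<and> f' (z t) = 0"
    by metis
  have less: "z s < z t" if "s \<in> ?T" "t \<in> ?T" "s < t" for s t
    using z[OF that(1)] z[OF that(2)] next_le[of t s] that by auto
  have inj: "inj_on z ?T"
    by (intro inj_onI) (metis less linorder_neqE_linordered_idom order_less_irrefl)
  have "card (z ` ?T) = n"
    using card_image[OF inj] Max_in[OF assms(2) ne] assms(2,3) by simp
  moreover have "z ` ?T \<subseteq> {a..b}"
    using z next_in assms(4) by fastforce
  ultimately show ?thesis
    using z assms(2) by (intro exI[of _ "z ` ?T"]) auto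
qed

lemma Rolle_derivative_chain:
  assumes "derivative_chain F" "finite T" "card T = Suc n" "T \<subseteq> {a..b}" "\<And>t. t \<in> T \<Longrightarrow> F 0 t = 0"
  shows "\<exists>\<xi>\<in>{a..b}. F n \<xi> = 0"
  using assms
proof (induction n arbitrary: F T)
  case 0
  then obtain t where "T = {t}" using card_1_singletonE by (metis One_nat_def)
  with 0 show ?case by auto
next
  case (Suc n)
  have D: "(F 0 has_real_derivative F 1 x) (at x)" for x
    using Suc.prems(1) by (simp add: derivative_chain_def)
  obtain U where "finite U" "card U = Suc n" "U \<subseteq> {a..b}" "\<forall>u\<in>U. F 1 u = 0"
    using Rolle_finite_set[OF D Suc.prems(2-5)] by blast
  then show ?case
    using Suc.IH[of "\<lambda>k. F (Suc k)" U] Suc.prems(1) by (auto simp: derivative_chain_def)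
qed

text \<open>The Lagrange form: the leading coefficient of the polynomial interpolating
  \<open>u\<close> on \<open>T\<close>. Nodes form a set, so they are distinct and
  unordered.\<close>

definition divided_difference :: "real set \<Rightarrow> (real \<Rightarrow> real) \<Rightarrow> real" where
  "divided_difference T u = (\<Sum>t\<in>T. u t / (\<Prod>s\<in>T - {t}. t - s))"

lemma higher_pderiv_degree:
  fixes p :: "real poly"
  assumes "degree p \<le> n"
  shows "(pderiv ^^ n) p = [:fact n * coeff p n:]"
proof (rule poly_eqI)
  fix i
  show "coeff ((pderiv ^^ n) p) i = coeff [:fact n * coeff p n:] i"
  proof (cases i)
    case 0
    then show ?thesis by (simp add: coeff_higher_pderiv pochhammer_fact)
  next
    case (Suc j)
    then show ?thesis using assms by (simp add: coeff_higher_pderiv coeff_eq_0)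
  qed
qed

text \<open>\<open>F 0\<close> minus its Lagrange interpolant \<open>p\<close> vanishes at all
  \<open>n + 1\<close> nodes, so its \<open>n\<close>th derivative has a zero. The
  \<open>n\<close>th derivative of \<open>p\<close> is the constant \<open>fact n\<close> times its
  leading coefficient, which is the divided difference.\<close>

lemma divided_difference_mean_value:
  assumes F: "derivative_chain F" and "finite T" "card T = Suc n" "T \<subseteq> {a..b}"
  shows "\<exists>\<xi>\<in>{a..b}. divided_difference T (F 0) = F n \<xi> / fact n"
proof -
  define w where "w t = (\<Prod>s\<in>T - {t}. t - s)" for t
  define l where "l t = (\<Prod>s\<in>T - {t}. [:-s, 1:])" for t
  define p where "p = (\<Sum>t\<in>T. smult (F 0 t / w t) (l t))"
  have w: "w t \<noteq> 0" if "t \<in> T" for t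
    using assms(2) by (simp add: w_def)
  have deg_l: "degree (l t) = n" if "t \<in> T" for t
    unfolding l_def using that assms(2,3) by (subst degree_prod_eq_sum_degree) auto
  have lead_l: "coeff (l t) n = 1" if "t \<in> T" for t
    using deg_l[OF that] lead_coeff_prod[of "\<lambda>s. [:-s, 1:]" "T - {t}"] by (simp add: l_def)
  have poly_l: "poly (l t) s = (if s = t then w t else 0)" if "s \<in> T" for s t
    using that assms(2) by (auto simp: l_def w_def poly_prod)
  have "poly p s = F 0 s" if "s \<in> T" for s
    using that w assms(2) by (simp add: p_def poly_sum poly_l if_distrib[of "\<lambda>x. _ * x"] cong: if_cong)
  moreover have "degree p \<le> n"
    unfolding p_def using assms(2) deg_l by (intro degree_sum_le order_trans[OF degree_smult_le]) auto
  moreover have "coeff p n = divided_difference T (F 0)"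
    by (simp add: p_def coeff_sum lead_l divided_difference_def w_def)
  moreover have "derivative_chain (\<lambda>k x. F k x - poly ((pderiv ^^ k) p) x)"
    using F by (auto simp: derivative_chain_def intro!: DERIV_diff poly_DERIV)
  ultimately show ?thesis
    using Rolle_derivative_chain[of "\<lambda>k x. F k x - poly ((pderiv ^^ k) p) x" T n a b] assms
    by (force simp: higher_pderiv_degree)
qed

section \<open>Divided differences of functions with a bounded weak derivative\<close>

lemma integral_lebesgue_on_derivative:
  fixes f :: "real \<Rightarrow> real"
  assumes "a \<le> b" "\<And>x. (G has_real_derivative f x) (at x)" "continuous_on {a..b} f"
  shows "integral\<^sup>L (lebesgue_on {a..b}) f = G b - G a"
proof -
  have "(f has_integral (G b - G a)) {a..b}"
    using assms(1,2)
    by (intro fundamental_theorem_of_calculus)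
       (auto simp: has_real_derivative_iff_has_vector_derivative[symmetric] intro: DERIV_subset)
  then show ?thesis
    using lebesgue_integral_eq_integral[OF continuous_imp_integrable_real[OF assms(3)]]
    by (simp add: integral_unique)
qed

lemma derivative_chain_shift:
  assumes "derivative_chain R"
  shows "((\<lambda>x. R k (x - s)) has_real_derivative R (Suc k) (x - s)) (at x)"
    and "((\<lambda>s. R k (x - s)) has_real_derivative - R (Suc k) (x - s)) (at s)"
proof -
  have R: "(R k has_real_derivative R (Suc k) (x - s)) (at (x - s))"
    using assms by (simp add: derivative_chain_def)
  have "((\<lambda>x. x - s) has_real_derivative 1) (at x)" "((\<lambda>s. x - s) has_real_derivative -1) (at s)"
    by (auto intro!: derivative_eq_intros)
  from DERIV_chain2[where g = "\<lambda>x. x - s", OF R this(1)] DERIV_chain2[where g = "\<lambda>s. x - s", OF R this(2)]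
  show "((\<lambda>x. R k (x - s)) has_real_derivative R (Suc k) (x - s)) (at x)"
    "((\<lambda>s. R k (x - s)) has_real_derivative - R (Suc k) (x - s)) (at s)" by simp_all
qed

lemma derivative_chain_divided_difference:
  assumes "derivative_chain R"
  shows "derivative_chain (\<lambda>k x. divided_difference T (\<lambda>s. R k (x - s)))"
  unfolding derivative_chain_def divided_difference_def
  by (intro allI DERIV_sum DERIV_cdivide derivative_chain_shift assms)

text \<open>The mean value theorem is applied in the node variable \<open>s\<close>: each derivative
  in \<open>s\<close> moves one step up the chain and contributes a factor -1.\<close>

lemma divided_difference_mean_value_shift:
  assumes "derivative_chain R" "finite T" "card T = Suc n" "T \<subseteq> {a..b}"
  shows "\<exists>\<xi>\<in>{a..b}. divided_difference T (\<lambda>s. R k (x - s)) = (-1) ^ n * R (k + n) (x - \<xi>) / fact n"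
proof -
  from DERIV_cmult[OF derivative_chain_shift(2)[OF assms(1)]]
  have "derivative_chain (\<lambda>j s. (-1) ^ j * R (k + j) (x - s))"
    by (force simp: derivative_chain_def)
  from divided_difference_mean_value[OF this assms(2-4)] show ?thesis by simp
qed

lemma Linf_norm_le_AE:
  assumes "Linf_norm h \<le> ereal M"
  shows "AE x in lebesgue_on {0..1}. \<bar>h x\<bar> \<le> M"
proof -
  have "AE x in lebesgue_on {0..1}. ereal \<bar>h x\<bar> \<le> Linf_norm h"
    unfolding Linf_norm_def by (rule esssup_AE)
  then show ?thesis
    by (rule eventually_mono) (use assms order_trans in fastforce)
qed

text \<open>The test function is the divided difference in \<open>s\<close> of \<open>R 1 (x - s)\<close>: here \<open>R 1\<close> is a mollified
  truncated power and \<open>R (Suc r)\<close> the bump.\<close>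

lemma mollified_divided_difference_bound:
  assumes h: "Linf_norm h \<le> ereal M" "weak_derivative r g h"
    and g: "continuous_on {0..1} g"
    and R: "derivative_chain R" "\<And>x. R (Suc r) x \<ge> 0" "\<And>x. \<bar>x\<bar> \<ge> \<delta> \<Longrightarrow> R (Suc r) x = 0"
      "\<And>x. x \<le> -\<delta> \<Longrightarrow> R r x = 0" "\<And>x. x \<ge> \<delta> \<Longrightarrow> R r x = 1"
    and T: "finite T" "card T = Suc r" "T \<subseteq> {a + \<delta>..b - \<delta>}"
    and ab: "0 < a" "b < 1" "0 < \<delta>"
  shows "\<bar>divided_difference T (\<lambda>t. integral\<^sup>L (lebesgue_on {0..1}) (\<lambda>x. g x * R (Suc r) (x - t)))\<bar>
     \<le> M / fact r"
proof -
  \<comment> \<open>\<open>D 1\<close> is the test function, \<open>D 0\<close> a primitive that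
    yields its integral, and \<open>D (Suc r)\<close> its \<open>r\<close>th derivative.\<close>
  define D where "D k x = divided_difference T (\<lambda>s. R k (x - s))" for k x
  have D: "derivative_chain D"
    unfolding D_def by (rule derivative_chain_divided_difference[OF R(1)])
  have mean: "\<exists>\<xi>\<in>{a + \<delta>..b - \<delta>}. D k x = (-1) ^ r * R (k + r) (x - \<xi>) / fact r" for k x
    unfolding D_def by (rule divided_difference_mean_value_shift[OF R(1) T])
  let ?L = "integral\<^sup>L (lebesgue_on {0..1::real})"
  have cont: "continuous_on S (D k)" for S k
    by (rule derivative_chain_continuous[OF D])
  have deriv_D: "(deriv ^^ k) (D 1) = D (Suc k)" for k
    using derivative_chain_funpow_deriv[of "\<lambda>k. D (Suc k)" k] D by (simp add: derivative_chain_def)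
  have "a \<le> b"
  proof -
    have "T \<noteq> {}" using T(2) by auto
    with T(3) ab show ?thesis by fastforce
  qed
  have "test_function (D 1)"
  proof -
    have "D (Suc k) differentiable at x" for k x
      using D real_differentiable_def unfolding derivative_chain_def by blast
    \<comment> \<open>The mean value point lies in the interval of the nodes, so outside
      \<open>{a..b}\<close> it is at distance at least \<open>\<delta>\<close> from
      \<open>x\<close>, where the bump vanishes.\<close>
    moreover have "D 1 x = 0" if "x \<notin> {a..b}" for x
      using mean[of 1 x] that ab R(3) by fastforce
    ultimately show ?thesis
      unfolding test_function_def deriv_D using ab \<open>a \<le> b\<close> by blast
  qed
  then have weak: "?L (\<lambda>x. g x * D (Suc r) x) = (-1) ^ r * ?L (\<lambda>x. h x * D 1 x)"
    using h(2) unfolding weak_derivative_def by (metis deriv_D)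
  \<comment> \<open>The constant sign turns the L1 norm of \<open>D 1\<close> into its integral up
    to sign, that is, into a difference of values of \<open>D 0\<close>.\<close>
  have sign: "(-1) ^ r * D 1 x \<ge> 0" for x
  proof -
    obtain \<xi> where "D 1 x = (-1) ^ r * R (1 + r) (x - \<xi>) / fact r" using mean[of 1 x] by blast
    then show ?thesis using R(2) by (simp flip: power_mult_distrib mult.assoc)
  qed
  have abs_D: "\<bar>D 1 x\<bar> = (-1) ^ r * D 1 x" for x
    using sign[of x] by (cases "even r") auto
  \<comment> \<open>For \<open>k = 0\<close> the mean value formula involves the smoothed step
    \<open>R r\<close>, which is already 1 at \<open>1 - \<xi>\<close> and still 0 at
    \<open>-\<zeta>\<close>.\<close>
  have D0: "D 0 1 - D 0 0 = (-1) ^ r / fact r"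
  proof -
    obtain \<xi> where "\<xi> \<in> {a + \<delta>..b - \<delta>}" "D 0 1 = (-1) ^ r * R (0 + r) (1 - \<xi>) / fact r"
      using mean[of 0 1] by blast
    moreover obtain \<zeta> where "\<zeta> \<in> {a + \<delta>..b - \<delta>}" "D 0 0 = (-1) ^ r * R (0 + r) (0 - \<zeta>) / fact r"
      using mean[of 0 0] by blast
    ultimately show ?thesis using R(4)[of "-\<zeta>"] R(5)[of "1 - \<xi>"] ab by simp
  qed
  have "?L (D 1) = D 0 1 - D 0 0"
    using D by (intro integral_lebesgue_on_derivative cont) (auto simp: derivative_chain_def)
  then have int_abs: "?L (\<lambda>x. \<bar>D 1 x\<bar>) = 1 / fact r"
    unfolding abs_D by (simp add: D0 flip: power_mult_distrib)
  have "\<bar>?L (\<lambda>x. h x * D 1 x)\<bar> \<le> ?L (\<lambda>x. \<bar>h x * D 1 x\<bar>)"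
    by (rule integral_abs_bound)
  also have "\<dots> \<le> ?L (\<lambda>x. M * \<bar>D 1 x\<bar>)"
  proof (rule integral_mono_AE')
    show "integrable (lebesgue_on {0..1}) (\<lambda>x. M * \<bar>D 1 x\<bar>)"
      by (intro continuous_imp_integrable_real continuous_intros cont)
    show "AE x in lebesgue_on {0..1}. \<bar>h x * D 1 x\<bar> \<le> M * \<bar>D 1 x\<bar>"
      using Linf_norm_le_AE[OF h(1)]
      by (rule eventually_mono) (simp add: abs_mult mult_right_mono)
    show "AE x in lebesgue_on {0..1}. 0 \<le> M * \<bar>D 1 x\<bar>"
      using Linf_norm_le_AE[OF h(1)] by (rule eventually_mono) simp
  qed
  also have "\<dots> = M / fact r" using int_abs by simp
  finally have "\<bar>?L (\<lambda>x. g x * D (Suc r) x)\<bar> \<le> M / fact r"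
    by (simp add: weak abs_mult power_abs)
  moreover have "?L (\<lambda>x. g x * D (Suc r) x)
      = divided_difference T (\<lambda>t. ?L (\<lambda>x. g x * R (Suc r) (x - t)))"
  proof -
    have "integrable (lebesgue_on {0..1}) (\<lambda>x. g x * R (Suc r) (x - t))" for t
      by (intro continuous_imp_integrable_real continuous_intros g
          continuous_on_compose2[OF derivative_chain_continuous[OF R(1), of UNIV]]) auto
    then show ?thesis
      by (simp add: D_def divided_difference_def sum_distrib_left integral_sum)
  qed
  ultimately show ?thesis by simp
qed

text \<open>Since \<open>t\<close> keeps distance \<open>\<delta>\<close> from both ends, the bump
  centred at \<open>t\<close> has its full mass 1 on the interval. The error is thus a weighted
  average of \<open>g x - g t\<close> over points close to \<open>t\<close>.\<close>

lemma mollification_error: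
  assumes g: "continuous_on {0..1} g"
    and R: "derivative_chain R" "\<And>x. R (Suc r) x \<ge> 0" "\<And>x. \<bar>x\<bar> \<ge> \<delta> \<Longrightarrow> R (Suc r) x = 0"
      "\<And>x. x \<le> -\<delta> \<Longrightarrow> R r x = 0" "\<And>x. x \<ge> \<delta> \<Longrightarrow> R r x = 1"
    and t: "\<delta> \<le> t" "t \<le> 1 - \<delta>"
    and close: "\<And>x. x \<in> {0..1} \<Longrightarrow> \<bar>x - t\<bar> < \<delta> \<Longrightarrow> \<bar>g x - g t\<bar> \<le> \<eta>"
  shows "\<bar>integral\<^sup>L (lebesgue_on {0..1}) (\<lambda>x. g x * R (Suc r) (x - t)) - g t\<bar> \<le> \<eta>"
proof -
  let ?L = "integral\<^sup>L (lebesgue_on {0..1::real})"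
  let ?\<rho> = "\<lambda>x. R (Suc r) (x - t)"
  have cont: "continuous_on S ?\<rho>" for S
    by (intro continuous_intros continuous_on_compose2[OF derivative_chain_continuous[OF R(1), of UNIV]]) auto
  have "?L ?\<rho> = R r (1 - t) - R r (0 - t)"
    by (intro integral_lebesgue_on_derivative cont derivative_chain_shift R(1)) auto
  then have one: "?L ?\<rho> = 1"
    using R(4)[of "- t"] R(5)[of "1 - t"] t by simp
  have int: "integrable (lebesgue_on {0..1}) (\<lambda>x. g x * ?\<rho> x)" "integrable (lebesgue_on {0..1}) ?\<rho>"
    by (intro continuous_imp_integrable_real continuous_intros g cont)+
  have "?L (\<lambda>x. g x * ?\<rho> x) - g t = ?L (\<lambda>x. g x * ?\<rho> x) - ?L (\<lambda>x. g t * ?\<rho> x)"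
    by (simp add: one)
  also have "\<dots> = ?L (\<lambda>x. g x * ?\<rho> x - g t * ?\<rho> x)"
    by (rule Bochner_Integration.integral_diff[symmetric]) (use int in auto)
  also have "\<bar>\<dots>\<bar> \<le> ?L (\<lambda>x. \<bar>g x * ?\<rho> x - g t * ?\<rho> x\<bar>)"
    by (rule integral_abs_bound)
  also have "\<dots> \<le> ?L (\<lambda>x. \<eta> * ?\<rho> x)"
  proof (rule integral_mono)
    show "integrable (lebesgue_on {0..1}) (\<lambda>x. \<bar>g x * ?\<rho> x - g t * ?\<rho> x\<bar>)"
      "integrable (lebesgue_on {0..1}) (\<lambda>x. \<eta> * ?\<rho> x)"
      using int by auto
    fix x assume x: "x \<in> space (lebesgue_on {0..1::real})"
    have "\<bar>g x - g t\<bar> * ?\<rho> x \<le> \<eta> * ?\<rho> x"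
    proof (cases "\<bar>x - t\<bar> < \<delta>")
      case True
      then show ?thesis using close[of x] x R(2) by (intro mult_right_mono) auto
    next
      case False
      then show ?thesis using R(3)[of "x - t"] by simp
    qed
    then show "\<bar>g x * ?\<rho> x - g t * ?\<rho> x\<bar> \<le> \<eta> * ?\<rho> x"
      using R(2) by (simp add: abs_mult flip: left_diff_distrib)
  qed
  also have "\<dots> = \<eta>" by (simp add: one)
  finally show ?thesis .
qed

text \<open>Interior nodes leave room for the bumps. Mollifying \<open>g\<close> changes each nodal
  value by at most \<open>\<eta>\<close>, hence the divided difference by at most
  \<open>\<eta> * K\<close>, and \<open>\<eta>\<close> is arbitrary.\<close>

lemma divided_difference_bound_interior:
  assumes h: "Linf_norm h \<le> ereal M" "weak_derivative r g h"
    and g: "continuous_on {0..1} g"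
    and T: "finite T" "card T = Suc r" "T \<subseteq> {0<..<1}"
  shows "\<bar>divided_difference T g\<bar> \<le> M / fact r"
proof -
  define w where "w t = (\<Prod>s\<in>T - {t}. t - s)" for t
  define K where "K = (\<Sum>t\<in>T. 1 / \<bar>w t\<bar>)"
  have "K \<ge> 0" unfolding K_def by (intro sum_nonneg) auto
  obtain l u where lu: "0 < l" "u < 1" "T \<subseteq> {l..u}"
  proof
    have "T \<noteq> {}" using T(2) by auto
    then show "0 < Min T" "Max T < 1" using T(1,3) by auto
    show "T \<subseteq> {Min T..Max T}" using T(1) by auto
  qed
  have bound: "\<bar>divided_difference T g\<bar> \<le> M / fact r + \<eta> * K" if "\<eta> > 0" for \<eta>
  proof -
    obtain d where "d > 0" and d: "\<And>x t. x \<in> {0..1} \<Longrightarrow> t \<in> {0..1} \<Longrightarrow> dist x t < d \<Longrightarrow> dist (g x) (g t) < \<eta>"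
      by (rule uniformly_continuous_onE[OF compact_uniformly_continuous[OF g compact_Icc] \<open>\<eta> > 0\<close>]) blast
    \<comment> \<open>Uniform continuity asks for at most \<open>d\<close>. Half of each gap to the
      endpoints is left to the smoothing, so the test function stays supported in
      \<open>{l / 2..(1 + u) / 2}\<close>, inside the open unit interval.\<close>
    define \<delta> where "\<delta> = min d (min (l / 2) ((1 - u) / 2))"
    have \<delta>: "\<delta> > 0" "\<delta> \<le> d" "\<delta> \<le> l / 2" "\<delta> \<le> (1 - u) / 2"
      using \<open>d > 0\<close> lu(1,2) by (simp_all add: \<delta>_def min_le_iff_disj del: le_divide_eq_numeral1)
    have T_sub: "T \<subseteq> {l / 2 + \<delta>..(1 + u) / 2 - \<delta>}"
    proof
      fix t assume "t \<in> T"
      then have "l \<le> t" "t \<le> u" using lu(3) by auto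
      with \<delta> show "t \<in> {l / 2 + \<delta>..(1 + u) / 2 - \<delta>}" by (simp add: field_simps)
    qed
    obtain R where R: "derivative_chain R" "\<And>x. R (Suc r) x \<ge> 0" "\<And>x. \<bar>x\<bar> \<ge> \<delta> \<Longrightarrow> R (Suc r) x = 0"
      "\<And>x. x \<le> -\<delta> \<Longrightarrow> R r x = 0" "\<And>x. x \<ge> \<delta> \<Longrightarrow> R r x = 1"
      using mollifier_chain[OF \<delta>(1), of r] by blast
    define G where "G t = integral\<^sup>L (lebesgue_on {0..1}) (\<lambda>x. g x * R (Suc r) (x - t))" for t
    have "\<bar>G t - g t\<bar> \<le> \<eta>" if "t \<in> T" for t
      unfolding G_def
    proof (rule mollification_error[OF g R])
      have t: "t \<in> {0<..<1}" "t \<in> {l / 2 + \<delta>..(1 + u) / 2 - \<delta>}"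
        using that T(3) T_sub by blast+
      then show "\<delta> \<le> t" "t \<le> 1 - \<delta>" using lu(1,2) by (simp_all add: field_simps)
      show "\<bar>g x - g t\<bar> \<le> \<eta>" if "x \<in> {0..1}" "\<bar>x - t\<bar> < \<delta>" for x
        using d[of x t] that t(1) \<delta>(2) by (simp add: dist_real_def)
    qed
    then have "\<bar>(\<Sum>t\<in>T. (g t - G t) / w t)\<bar> \<le> (\<Sum>t\<in>T. \<eta> * (1 / \<bar>w t\<bar>))"
      by (intro order_trans[OF sum_abs] sum_mono)
         (auto simp: abs_minus_commute intro: divide_right_mono)
    then have "\<bar>divided_difference T g - divided_difference T G\<bar> \<le> \<eta> * K"
      by (simp add: divided_difference_def w_def K_def diff_divide_distrib sum_subtractf sum_distrib_left)
    moreover have "\<bar>divided_difference T G\<bar> \<le> M / fact r"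
      unfolding G_def
      by (rule mollified_divided_difference_bound[OF h g R T(1,2) T_sub]) (use lu(1,2) \<delta> in auto)
    ultimately show ?thesis by linarith
  qed
  have "\<bar>divided_difference T g\<bar> \<le> M / fact r + e" if "e > 0" for e
  proof -
    \<comment> \<open>The denominator \<open>K + 1\<close> is positive although only
      \<open>K \<ge> 0\<close> has been established.\<close>
    have "e / (K + 1) * K \<le> e" using that \<open>K \<ge> 0\<close> by (simp add: field_simps)
    moreover have "\<bar>divided_difference T g\<bar> \<le> M / fact r + e / (K + 1) * K"
      using that \<open>K \<ge> 0\<close> by (intro bound) auto
    ultimately show ?thesis by linarith
  qed
  then show ?thesis by (rule field_le_epsilon)
qed

text \<open>Contracting the nodes towards 1/2 by the factor \<open>1 - s\<close> moves them into the
  open interval, where the bound is known. As \<open>s\<close> tends to 0 the bound survives by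
  continuity of \<open>g\<close> up to the endpoints.\<close>

lemma divided_difference_bound:
  assumes h: "Linf_norm h \<le> ereal M" "weak_derivative r g h"
    and g: "continuous_on {0..1} g"
    and T: "finite T" "card T = Suc r" "T \<subseteq> {0..1}"
  shows "\<bar>divided_difference T g\<bar> \<le> M / fact r"
proof -
  define c where "c s t = (1 - s) * t + s / 2" for s t :: real
  have c_range: "0 < c s t \<and> c s t < 1" if "0 < s" "s < 1" "t \<in> {0..1}" for s t
  proof -
    have "0 \<le> (1 - s) * t" "(1 - s) * t \<le> 1 - s"
      using that mult_left_mono[of t 1 "1 - s"] by auto
    then show ?thesis unfolding c_def using that(1) by linarith
  qed
  have "\<bar>divided_difference (c s ` T) g\<bar> \<le> M / fact r" if s: "0 < s" "s < 1" for s
  proof (rule divided_difference_bound_interior[OF h g])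
    have inj: "inj_on (c s) T" using s by (auto simp: inj_on_def c_def)
    then show "card (c s ` T) = Suc r" using T(2) by (simp add: card_image)
    have "0 < c s t \<and> c s t < 1" if "t \<in> T" for t
      using c_range[OF s] that T(3) by blast
    then show "c s ` T \<subseteq> {0<..<1}" by auto
  qed (use T in simp)
  \<comment> \<open>Reindexing over the fixed set \<open>T\<close> allows the limit to be taken term
    by term.\<close>
  moreover have "divided_difference (c s ` T) g = (\<Sum>t\<in>T. g (c s t) / (\<Prod>u\<in>T - {t}. c s t - c s u))"
    if s: "0 < s" "s < 1" for s
  proof -
    have inj: "inj_on (c s) T" using s by (auto simp: inj_on_def c_def)
    have "c s ` T - {c s t} = c s ` (T - {t})" if "t \<in> T" for t
      using inj that by (auto simp: inj_on_def)
    then show ?thesis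
      unfolding divided_difference_def using inj
      by (simp add: sum.reindex prod.reindex inj_on_diff)
  qed
  ultimately have "eventually (\<lambda>s. \<bar>\<Sum>t\<in>T. g (c s t) / (\<Prod>u\<in>T - {t}. c s t - c s u)\<bar> \<le> M / fact r) (at_right 0)"
    by (intro eventually_at_rightI[of 0 1]) auto
  moreover have "((\<lambda>s. \<bar>\<Sum>t\<in>T. g (c s t) / (\<Prod>u\<in>T - {t}. c s t - c s u)\<bar>) \<longlongrightarrow>
     \<bar>\<Sum>t\<in>T. g t / (\<Prod>u\<in>T - {t}. t - u)\<bar>) (at_right 0)"
  proof (intro tendsto_intros)
    show c: "((\<lambda>s. c s t) \<longlongrightarrow> t) (at_right 0)" "((\<lambda>s. c s t) \<longlongrightarrow> t) (at_right 0)" for t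
      unfolding c_def by (auto intro!: tendsto_eq_intros)
    show "((\<lambda>s. g (c s t)) \<longlongrightarrow> g t) (at_right 0)" if "t \<in> T" for t
    proof (rule continuous_on_tendsto_compose[OF g c(1)])
      show "t \<in> {0..1}" using that T(3) by blast
      show "\<forall>\<^sub>F s in at_right 0. c s t \<in> {0..1}"
        using c_range \<open>t \<in> {0..1}\<close>
        by (intro eventually_at_rightI[of 0 1]) (auto simp: less_imp_le)
    qed
    show "(\<Prod>u\<in>T - {t}. t - u) \<noteq> 0" for t using T(1) by simp
  qed
  ultimately show ?thesis
    unfolding divided_difference_def by (intro tendsto_upperbound) auto
qed

text \<open>In the divided difference over \<open>insert x Z\<close> only the term of
  \<open>x\<close> survives. Its denominator is a product of distances within the unit interval,
  hence at most 1 in absolute value.\<close>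

lemma zeros_bound:
  assumes h: "Linf_norm h \<le> ereal M" "weak_derivative r g h"
    and g: "continuous_on {0..1} g" and "M \<ge> 0"
    and Z: "finite Z" "card Z = r" "Z \<subseteq> {0..1}" "\<And>z. z \<in> Z \<Longrightarrow> g z = 0"
    and x: "x \<in> {0..1}"
  shows "\<bar>g x\<bar> \<le> M / fact r"
proof (cases "x \<in> Z")
  case False
  let ?w = "\<Prod>z\<in>Z. x - z"
  have "divided_difference (insert x Z) g = g x / ?w"
    using Z False by (simp add: divided_difference_def insert_Diff_if)
  then have "\<bar>g x\<bar> / \<bar>?w\<bar> \<le> M / fact r"
    using divided_difference_bound[OF h g, of "insert x Z"] Z x False by simp
  moreover have "\<bar>?w\<bar> > 0" using Z(1) False by simp
  ultimately have "\<bar>g x\<bar> \<le> M / fact r * \<bar>?w\<bar>" by (simp add: field_simps)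
  also have "\<bar>?w\<bar> \<le> 1"
    unfolding abs_prod using Z(3) x by (intro prod_le_1) (fastforce simp: abs_le_iff)
  then have "M / fact r * \<bar>?w\<bar> \<le> M / fact r"
    using \<open>M \<ge> 0\<close> by (intro mult_left_le) auto
  finally show ?thesis .
qed (use Z \<open>M \<ge> 0\<close> in auto)

section \<open>The cost of testing the start point\<close>

text \<open>An empty history asks for \<open>z\<close>; afterwards the first observation is hidden
  from \<open>q\<close>, which therefore sees the history of its own run.\<close>

lemma observe_prepend:
  "observe (\<lambda>y. if y = [] then z else q (tl y)) f (Suc n) = f z # observe q f n"
  by (induction n) simp_all

text \<open>The source of the additional function value. If \<open>f z = 0\<close>, the remaining
  nodes are still queried but their values are ignored, which keeps the number of values
  fixed.\<close>

lemma deterministic_algorithm_test_first: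
  assumes "deterministic_algorithm D n S" "z \<in> D"
  shows "deterministic_algorithm D (n + 1) (\<lambda>f. if f z = 0 then g else S f)"
proof -
  obtain q out where q: "\<And>y. q y \<in> D" and out: "\<And>f. S f = out (observe q f n)"
    using assms(1) unfolding deterministic_algorithm_def by blast
  show ?thesis
    unfolding deterministic_algorithm_def
    by (rule exI[of _ "\<lambda>y. if y = [] then z else q (tl y)"],
        rule exI[of _ "\<lambda>y. if hd y = 0 then g else out (tl y)"])
       (use q out assms(2) observe_prepend[of z q _ n] in \<open>simp del: observe.simps\<close>)
qed

lemma sup_norm_le_iff: "sup_norm D g \<le> ereal B \<longleftrightarrow> (\<forall>x\<in>D. \<bar>g x\<bar> \<le> B)"
  by (simp add: sup_norm_def SUP_le_iff)

section \<open>Zeros of rank-one functions and random points\<close>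

text \<open>The split is on whether all factors have finitely many zeros. An infinite zero set
  supplies the \<open>r\<close> zeros that make its factor small, and the other factors are bounded
  by 1.\<close>

lemma rank_one_class_cases:
  assumes f: "f \<in> rank_one_class r M d" and M: "0 < M" "M \<le> fact r * \<epsilon>"
  shows "(\<forall>x\<in>cube d. \<bar>f x\<bar> \<le> \<epsilon>) \<or>
    (\<exists>Z. (\<forall>i\<in>{1..d}. finite (Z i)) \<and> (\<forall>x\<in>cube d. f x = 0 \<longleftrightarrow> (\<exists>i\<in>{1..d}. x i \<in> Z i)))"
proof -
  obtain fs where fs: "\<And>i. i \<in> {1..d} \<Longrightarrow> fs i \<in> sobolev_inf r"
    "\<And>i. i \<in> {1..d} \<Longrightarrow> sup_norm {0..1} (fs i) \<le> 1"
    "\<And>i. i \<in> {1..d} \<Longrightarrow> \<exists>h\<in>Linf. weak_derivative r (fs i) h \<and> Linf_norm h \<le> ereal M"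
    and f_eq: "\<And>x. x \<in> cube d \<Longrightarrow> f x = (\<Prod>i=1..d. fs i (x i))"
    using f unfolding rank_one_class_def by blast
  define Z where "Z i = {t\<in>{0..1}. fs i t = 0}" for i
  have cube: "x i \<in> {0..1}" if "x \<in> cube d" "i \<in> {1..d}" for x i
    using that unfolding cube_def by (rule PiE_mem)
  show ?thesis
  proof (cases "\<forall>i\<in>{1..d}. finite (Z i)")
    case True
    have "f x = 0 \<longleftrightarrow> (\<exists>i\<in>{1..d}. x i \<in> Z i)" if "x \<in> cube d" for x
      using f_eq[OF that] cube[OF that] by (auto simp: Z_def)
    with True show ?thesis by blast
  next
    case False
    then obtain i where i: "i \<in> {1..d}" "infinite (Z i)" by blast
    from infinite_arbitrarily_large[OF i(2), of r]
    obtain Y where Y: "finite Y" "card Y = r" "Y \<subseteq> Z i" by blast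
    obtain h where h: "weak_derivative r (fs i) h" "Linf_norm h \<le> ereal M"
      using fs(3)[OF i(1)] by blast
    have "\<bar>fs i t\<bar> \<le> M / fact r" if "t \<in> {0..1}" for t
      by (rule zeros_bound[OF h(2,1)]) (use fs(1)[OF i(1)] that M Y in \<open>auto simp: sobolev_inf_def Z_def\<close>)
    moreover have "M / fact r \<le> \<epsilon>" using M by (simp add: field_simps)
    ultimately have small: "\<bar>fs i t\<bar> \<le> \<epsilon>" if "t \<in> {0..1}" for t using that by force
    have le1: "\<bar>fs j t\<bar> \<le> 1" if "j \<in> {1..d}" "t \<in> {0..1}" for j t
      using fs(2)[OF that(1)] that(2) sup_norm_le_iff[of "{0..1}" "fs j" 1] by (simp add: one_ereal_def)
    have "\<bar>f x\<bar> \<le> \<epsilon>" if x: "x \<in> cube d" for x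
    proof -
      have "\<bar>f x\<bar> = \<bar>fs i (x i)\<bar> * (\<Prod>j\<in>{1..d} - {i}. \<bar>fs j (x j)\<bar>)"
        unfolding f_eq[OF x] abs_prod by (rule prod.remove) (use i in auto)
      also have "\<dots> \<le> \<bar>fs i (x i)\<bar>"
        using le1 cube[OF x] by (intro mult_left_le prod_le_1) auto
      also have "\<dots> \<le> \<epsilon>" using small cube[OF x i(1)] by blast
      finally show ?thesis .
    qed
    then show ?thesis by blast
  qed
qed

text \<open>The law of \<open>X\<close> is a product of Lebesgue measures on the unit interval, and
  a finite set is null for each of them.\<close>

lemma uniform_on_cube_coordinate:
  assumes "uniform_on_cube P d X" "i \<in> {1..d}"
  shows "(\<lambda>\<omega>. X \<omega> i) \<in> borel_measurable P"
    and "finite Z \<Longrightarrow> AE \<omega> in P. X \<omega> i \<notin> Z"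
proof -
  let ?I = "restrict_space lborel {0..1::real}"
  have X: "X \<in> P \<rightarrow>\<^sub>M cube_measure d" "distr P (cube_measure d) X = density (cube_measure d) (\<lambda>_. 1)"
    using assms(1) unfolding uniform_on_cube_def distributed_def by auto
  have "(\<lambda>x. x i) \<in> cube_measure d \<rightarrow>\<^sub>M ?I"
    unfolding cube_measure_def using assms(2) by (rule measurable_component_singleton)
  from measurable_compose[OF X(1) this] have "(\<lambda>\<omega>. X \<omega> i) \<in> P \<rightarrow>\<^sub>M ?I" .
  then show "(\<lambda>\<omega>. X \<omega> i) \<in> borel_measurable P"
    by (simp add: measurable_restrict_space2_iff)
  assume "finite Z"
  have "AE x in lborel. x \<notin> Z"
    using countable_imp_null_set_lborel[OF countable_finite[OF \<open>finite Z\<close>]] by (rule AE_not_in)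
  then have "AE x in ?I. x \<notin> Z"
    by (subst AE_restrict_space_iff) auto
  moreover have "prob_space ?I"
    by (intro prob_spaceI) (simp add: emeasure_restrict_space space_restrict_space)
  ultimately have "AE x in cube_measure d. x i \<notin> Z"
    unfolding cube_measure_def using assms(2) by (intro AE_PiM_component)
  then have "AE x in distr P (cube_measure d) X. x i \<notin> Z"
    by (subst X(2)) (simp only: density_1)
  then show "AE \<omega> in P. X \<omega> i \<notin> Z"
    by (rule AE_distrD[OF X(1)])
qed

section \<open>Sample size and success probability\<close>

text \<open>As \<open>\<epsilon> < 1\<close>, the power of \<open>\<epsilon>\<close> is at least 1,
  so the known algorithm is applicable. Raising the bound on \<open>n\<close> to the power
  \<open>r\<close> gives n^r >= d^(r+1) c M / \<epsilon>, the accuracy claim rearranged.\<close>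

lemma sample_bound_ge:
  assumes "0 < \<epsilon>" "\<epsilon> < 1" "0 < M" "c > 0" "r \<ge> 1" "d \<ge> 1"
    and n: "real n \<ge> sample_bound c r M d \<epsilon>"
  shows "real n \<ge> real d * max ((real d * c * M) powr (1 / real r)) 2"
    and "c * M * real d ^ (r + 1) / real n ^ r \<le> \<epsilon>"
proof -
  let ?B = "(real d * c * M) powr (1 / real r)"
  have "\<epsilon> powr (- 1 / real r) \<ge> 1"
    using assms(1,2,5) by (simp add: powr_minus powr_le1 one_le_inverse)
  then have "?B \<le> \<epsilon> powr (- 1 / real r) * ?B"
    by (simp add: mult_le_cancel_right1)
  then have "real d * max ?B 2 \<le> sample_bound c r M d \<epsilon>"
    unfolding sample_bound_def by (intro mult_left_mono) auto
  with n show "real n \<ge> real d * max ?B 2" by linarith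
  let ?C = "\<epsilon> powr (- 1 / real r) * ?B"
  have pos: "real d * c * M > 0" using assms by simp
  have pow: "(x powr (1 / real r)) ^ r = x" if "x > 0" for x :: real
    using that assms(5) by (simp add: powr_powr flip: powr_realpow)
  have "\<epsilon> powr (- 1 / real r) = inverse (\<epsilon> powr (1 / real r))"
    by (simp add: powr_minus)
  then have "?C ^ r = real d * c * M / \<epsilon>"
    using pow[OF pos] pow[OF assms(1)] by (simp add: power_mult_distrib power_inverse divide_inverse)
  moreover have "real d * ?C \<le> real n"
    using n unfolding sample_bound_def by (smt (verit) max.cobounded1 mult_left_mono of_nat_0_le_iff)
  then have "(real d * ?C) ^ r \<le> real n ^ r" by (intro power_mono) auto
  ultimately have *: "real d ^ r * (real d * c * M / \<epsilon>) \<le> real n ^ r"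
    by (simp add: power_mult_distrib)
  moreover have "real d ^ r * (real d * c * M / \<epsilon>) > 0" using assms pos by simp
  ultimately have "real n ^ r > 0" by linarith
  then show "c * M * real d ^ (r + 1) / real n ^ r \<le> \<epsilon>"
    using * assms(1) by (simp add: field_simps)
qed

lemma S1_succeeds:
  assumes alg: "rank_one_algorithms c r M d A" and P: "prob_space P" and X: "uniform_on_cube P d X"
    and par: "0 < M" "M \<le> fact r * \<epsilon>"
    and n: "real n \<ge> real d * max ((real d * c * M) powr (1 / real r)) 2"
      "c * M * real d ^ (r + 1) / real n ^ r \<le> \<epsilon>"
    and f: "f \<in> rank_one_class r M d"
  shows "\<P>(\<omega> in P. sup_norm (cube d) (\<lambda>x. f x - S1 A X n f \<omega> x) \<le> ereal \<epsilon>) = 1"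
proof -
  interpret prob_space P by (rule P)
  have X_meas: "X \<in> P \<rightarrow>\<^sub>M cube_measure d"
    using X unfolding uniform_on_cube_def distributed_def by blast
  have X_cube: "X \<omega> \<in> cube d" if "\<omega> \<in> space P" for \<omega>
    using measurable_space[OF X_meas that] by (simp add: space_cube_measure)
  let ?Q = "\<lambda>\<omega>. sup_norm (cube d) (\<lambda>x. f x - S1 A X n f \<omega> x) \<le> ereal \<epsilon>"
  have nonzero: "?Q \<omega>" if "\<omega> \<in> space P" "f (X \<omega>) \<noteq> 0" for \<omega>
  proof -
    have "sup_norm (cube d) (\<lambda>x. f x - A n (X \<omega>) f x) \<le> ereal (c * M * real d ^ (r + 1) / real n ^ r)"
      using alg n(1) X_cube[OF that(1)] f that(2) unfolding rank_one_algorithms_def by blast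
    also have "\<dots> \<le> ereal \<epsilon>" using n(2) by simp
    finally show ?thesis using that(2) by (simp add: S1_def)
  qed
  show ?thesis
  proof (cases "\<forall>x\<in>cube d. \<bar>f x\<bar> \<le> \<epsilon>")
    case True
    have "?Q \<omega>" if "\<omega> \<in> space P" for \<omega>
      using nonzero[OF that] True by (cases "f (X \<omega>) = 0") (auto simp: S1_def sup_norm_le_iff)
    then have "{\<omega> \<in> space P. ?Q \<omega>} = space P" by blast
    then show ?thesis by (simp add: prob_space)
  next
    case False
    with rank_one_class_cases[OF f par] obtain Z where
      fin: "\<And>i. i \<in> {1..d} \<Longrightarrow> finite (Z i)" and
      Z: "\<And>x. x \<in> cube d \<Longrightarrow> f x = 0 \<longleftrightarrow> (\<exists>i\<in>{1..d}. x i \<in> Z i)" by blast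
    \<comment> \<open>Here the output 0 misses the tolerance, so success is equivalent to
      \<open>f (X \<omega>) \<noteq> 0\<close>. An equality of events is needed: an inclusion would
      not give measurability, and a non-measurable event has measure 0 by convention.\<close>
    have "?Q \<omega> \<longleftrightarrow> (\<forall>i\<in>{1..d}. X \<omega> i \<notin> Z i)" if "\<omega> \<in> space P" for \<omega>
      using nonzero[OF that] False Z[OF X_cube[OF that]]
      by (cases "f (X \<omega>) = 0") (auto simp: S1_def sup_norm_le_iff)
    then have eq: "{\<omega> \<in> space P. ?Q \<omega>} = {\<omega> \<in> space P. \<forall>i\<in>{1..d}. X \<omega> i \<notin> Z i}" by blast
    have "{\<omega> \<in> space P. \<forall>i\<in>{1..d}. X \<omega> i \<notin> Z i} \<in> sets P"
    proof (intro sets.sets_Collect_finite_All)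
      fix i assume i: "i \<in> {1..d}"
      note [measurable] = uniform_on_cube_coordinate(1)[OF X i]
      have [measurable]: "Z i \<in> sets borel" using fin[OF i] by (intro borel_closed finite_imp_closed)
      show "{\<omega> \<in> space P. X \<omega> i \<notin> Z i} \<in> sets P" by measurable
    qed simp
    moreover have "AE \<omega> in P. \<forall>i\<in>{1..d}. X \<omega> i \<notin> Z i"
      using uniform_on_cube_coordinate(2)[OF X] fin by (intro AE_finite_allI) auto
    ultimately show ?thesis unfolding eq by (simp add: prob_Collect_eq_1)
  qed
qed

theorem theorem6:
  fixes C :: "nat \<Rightarrow> real"
    and A :: "nat \<Rightarrow> point \<Rightarrow> (point \<Rightarrow> real) \<Rightarrow> (point \<Rightarrow> real)"
    and d r :: nat
    and \<epsilon> M :: real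
    and P :: "'w measure"
    and X :: "'w \<Rightarrow> point"
  assumes "d \<ge> 1" and "r \<ge> 1"
    and "0 < \<epsilon>" and "\<epsilon> < 1"
    and "0 < M" and "M \<le> fact r * \<epsilon>"
    and "C r > 0"
    and "rank_one_algorithms (C r) r M d A"
    and "prob_space P"
    and "uniform_on_cube P d X"
  shows "(\<forall>n. real n \<ge> sample_bound (C r) r M d \<epsilon> \<longrightarrow>
            (\<forall>f\<in>rank_one_class r M d.
               \<P>(\<omega> in P. sup_norm (cube d) (\<lambda>x. f x - S1 A X n f \<omega> x) \<le> ereal \<epsilon>) = 1)) \<and>
         (let N = nat \<lceil>sample_bound (C r) r M d \<epsilon>\<rceil> in
            (\<forall>\<omega>\<in>space P. deterministic_algorithm (cube d) (N + 1) (\<lambda>f. S1 A X N f \<omega>)) \<and>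
            (\<forall>f\<in>rank_one_class r M d.
               \<P>(\<omega> in P. sup_norm (cube d) (\<lambda>x. f x - S1 A X N f \<omega> x) \<le> ereal \<epsilon>) = 1))"
proof -
  have succ: "\<P>(\<omega> in P. sup_norm (cube d) (\<lambda>x. f x - S1 A X n f \<omega> x) \<le> ereal \<epsilon>) = 1"
    if "real n \<ge> sample_bound (C r) r M d \<epsilon>" "f \<in> rank_one_class r M d" for n f
    using S1_succeeds[OF assms(8-10,5,6) sample_bound_ge[OF assms(3,4,5,7,2,1) that(1)] that(2)] .
  define N where "N = nat \<lceil>sample_bound (C r) r M d \<epsilon>\<rceil>"
  have N: "real N \<ge> sample_bound (C r) r M d \<epsilon>"
    unfolding N_def by (rule real_nat_ceiling_ge)
  \<comment> \<open>For fixed \<open>\<omega>\<close> the start point is fixed too: one value tests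
    \<open>f\<close> there, and \<open>N\<close> values serve the algorithm.\<close>
  have "deterministic_algorithm (cube d) (N + 1) (\<lambda>f. S1 A X N f \<omega>)" if "\<omega> \<in> space P" for \<omega>
  proof -
    have "X \<in> P \<rightarrow>\<^sub>M cube_measure d"
      using assms(10) unfolding uniform_on_cube_def distributed_def by blast
    then have "X \<omega> \<in> cube d"
      using measurable_space[OF _ that] space_cube_measure by blast
    moreover from this have "deterministic_algorithm (cube d) N (A N (X \<omega>))"
      using assms(8) sample_bound_ge(1)[OF assms(3,4,5,7,2,1) N] unfolding rank_one_algorithms_def by blast
    ultimately show ?thesis
      unfolding S1_def by (intro deterministic_algorithm_test_first)
  qed
  then show ?thesis using succ N unfolding N_def[symmetric] Let_def by blast
qed

end
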